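(* There are infinitely many (pairwise non-isomorphic) finite, simple, connected graphs $G$ with $n(G) \geq \omega(G)+1 \geq 4$ such that $$\dim_{A,l}(G) = \dim_l(G) = \left\lfloor \left(\frac{\omega(G) - 2}{\omega(G) - 1}\right) n(G)\right\rfloor .$$
   Context: For a finite, simple, connected graph $G$ with vertex set $V(G)$, $n(G)=|V(G)|$ denotes its order, $\omega(G)$ its clique number (the largest number of pairwise adjacent vertices), and $d_G(u,v)$ the length of a shortest path between vertices $u$ and $v$. A vertex $w$ distinguishes $u$ and $v$ if $d_G(u,w)\neq d_G(v,w)$. For $S \subseteq V(G)$ let $\overline{S} = V(G)\setminus S$. The set $S$ is a local resolving set of $G$ if any two adjacent vertices from $\overline{S}$ are distinguished by a vertex from $S$; the local metric dimension $\dim_l(G)$ is the cardinality of a smallest local resolving set. The set $S$ is a local adjacency resolving set of $G$ if for any two adjacent vertices from $\overline{S}$ there exists a vertex of $S$ adjacent to exactly one of them; the local adjacency metric dimension $\dim_{A,l}(G)$ is the cardinality of a smallest local adjacency resolving set. *)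

theory Defs
  imports
    "Graph_Theory.Graph_Theory"
    "Graph_Theory.Shortest_Path"
begin

(* Undirected graphs are symmetric digraphs, as in the locales graph and pair_graph: every edge is
   a pair of opposite arcs. Adjacency of u and v is then u \<rightarrow>\<^bsub>G\<^esub> v. *)

(* Unspecified if there is no path from u to v; see graph_dist_eq_mu for the relation to \<mu>. *)
definition graph_dist :: "('a, 'b) pre_digraph \<Rightarrow> 'a \<Rightarrow> 'a \<Rightarrow> nat" where
  "graph_dist G u v = (LEAST k. \<exists>p. pre_digraph.apath G u p v \<and> length p = k)"

definition is_clique :: "('a, 'b) pre_digraph \<Rightarrow> 'a set \<Rightarrow> bool" where
  "is_clique G K \<longleftrightarrow> K \<subseteq> verts G \<and> (\<forall>u\<in>K. \<forall>v\<in>K. u \<noteq> v \<longrightarrow> u \<rightarrow>\<^bsub>G\<^esub> v)"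

definition clique_number :: "('a, 'b) pre_digraph \<Rightarrow> nat" where
  "clique_number G = Max (card ` {K. is_clique G K})"

definition distinguishes :: "('a, 'b) pre_digraph \<Rightarrow> 'a \<Rightarrow> 'a \<Rightarrow> 'a \<Rightarrow> bool" where
  "distinguishes G w u v \<longleftrightarrow> graph_dist G u w \<noteq> graph_dist G v w"

definition local_resolving_set :: "('a, 'b) pre_digraph \<Rightarrow> 'a set \<Rightarrow> bool" where
  "local_resolving_set G S \<longleftrightarrow> S \<subseteq> verts G \<and>
     (\<forall>u \<in> verts G - S. \<forall>v \<in> verts G - S. u \<rightarrow>\<^bsub>G\<^esub> v \<longrightarrow> (\<exists>w\<in>S. distinguishes G w u v))"

definition local_metric_dim :: "('a, 'b) pre_digraph \<Rightarrow> nat" where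
  "local_metric_dim G = (LEAST k. \<exists>S. local_resolving_set G S \<and> card S = k)"

definition local_adjacency_resolving_set :: "('a, 'b) pre_digraph \<Rightarrow> 'a set \<Rightarrow> bool" where
  "local_adjacency_resolving_set G S \<longleftrightarrow> S \<subseteq> verts G \<and>
     (\<forall>u \<in> verts G - S. \<forall>v \<in> verts G - S. u \<rightarrow>\<^bsub>G\<^esub> v \<longrightarrow>
        (\<exists>w\<in>S. (w \<rightarrow>\<^bsub>G\<^esub> u) \<noteq> (w \<rightarrow>\<^bsub>G\<^esub> v)))"

definition local_adjacency_metric_dim :: "('a, 'b) pre_digraph \<Rightarrow> nat" where
  "local_adjacency_metric_dim G = (LEAST k. \<exists>S. local_adjacency_resolving_set G S \<and> card S = k)"

lemma (in wf_digraph) graph_dist_eq_mu: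
  assumes "u \<rightarrow>\<^sup>* v"
  shows "ereal (real (graph_dist G u v)) = \<mu> (\<lambda>_. 1) u v"
proof -
  have cost: "awalk_cost (\<lambda>_. 1) p = real (length p)" for p
    by (induction p) simp_all
  obtain p0 where p0: "apath u p0 v"
    using assms reachable_apath by blast
  have "\<exists>p. apath u p v \<and> length p = graph_dist G u v"
    unfolding graph_dist_def
    by (rule LeastI[where P = "\<lambda>k. \<exists>p. apath u p v \<and> length p = k" and k = "length p0"])
       (use p0 in auto)
  then obtain p where p: "apath u p v" "length p = graph_dist G u v"
    by blast
  have least: "graph_dist G u v \<le> length q" if "awalk u q v" for q
  proof -
    from that have "\<exists>q'. apath u q' v \<and> length q' \<le> length q"
    proof (induction rule: awalk_to_apath_induct)
      case (path q)
      then show ?case unfolding apath_def by blast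
    next
      case (decomp q r c s)
      then have "q = r @ c @ s"
        using awalk_cyc_decompE[OF decomp(2) decomp(1) decomp(3)] by blast
      then have "length (r @ s) \<le> length q"
        by simp
      with decomp(4) show ?case
        using order_trans by blast
    qed
    then obtain q' where "apath u q' v" "length q' \<le> length q"
      by blast
    moreover from this(1) have "graph_dist G u v \<le> length q'"
      unfolding graph_dist_def by - (rule Least_le, blast)
    ultimately show ?thesis
      by linarith
  qed
  show ?thesis
    unfolding \<mu>_def
  proof (rule INF_eqI[symmetric])
    fix q assume "q \<in> {p. awalk u p v}"
    then show "ereal (real (graph_dist G u v)) \<le> ereal (awalk_cost (\<lambda>_. 1) q)"
      using least by (simp add: cost)
  next
    fix y :: ereal
    assume "\<And>q. q \<in> {p. awalk u p v} \<Longrightarrow> y \<le> ereal (awalk_cost (\<lambda>_. 1) q)"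
    from this[of p] show "y \<le> ereal (real (graph_dist G u v))"
      using p by (simp add: cost apath_def)
  qed
qed

end

theory Submission
  imports Defs
begin

text \<open>
  The witnesses are the graphs obtained from the complete graph on \<open>n \<ge> 4\<close> vertices by deleting one
  edge \<open>{0, 1}\<close>. Their clique number is \<open>\<omega> = n - 1\<close>, and
  \<open>(\<omega> - 2) / (\<omega> - 1) \<cdot> n = n - 1 - 2 / (n - 2)\<close>, whose floor is \<open>n - 2\<close>. Both dimensions are
  \<open>n - 2\<close> as well. Graphs for different \<open>n\<close> are non-isomorphic, having different orders.

  Upper bound: leave out only the vertices \<open>0\<close> and \<open>2\<close>; the vertex \<open>1\<close> is adjacent to \<open>2\<close> but not
  to \<open>0\<close>. This gives an adjacency resolving set, and in a connected graph every such set is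
  resolving, because adjacency means distance one
  (\<open>local_adjacency_imp_local_resolving_set\<close>).

  Lower bound: among any three vertices left out of \<open>S\<close> there are two adjacent ones, both of them
  adjacent to all of \<open>S\<close> (\<open>complete_minus_edge_twins\<close>), hence both at distance one from all of
  \<open>S\<close>. So even for a resolving set at most two vertices are left out.
\<close>

section \<open>Distances, resolving sets and isomorphisms\<close>

text \<open>
  Reachability guarantees that the minimum in the definition of the distance is attained; between
  vertices without a path the value of the distance is arbitrary and might be one.
\<close>
lemma (in wf_digraph) graph_dist_eq_1_iff:
  assumes "u \<rightarrow>\<^sup>* v" "u \<noteq> v"
  shows "graph_dist G u v = 1 \<longleftrightarrow> u \<rightarrow> v"
proof
  let ?P = "\<lambda>k. \<exists>p. apath u p v \<and> length p = k"
  assume "graph_dist G u v = 1"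
  moreover have "?P (graph_dist G u v)"
  proof -
    obtain p where "apath u p v"
      using assms(1) reachable_apath by blast
    then have "?P (length p)"
      by blast
    then show ?thesis
      unfolding graph_dist_def by (rule LeastI)
  qed
  ultimately obtain p where "apath u p v" "length p = 1"
    by auto
  then obtain a where "apath u [a] v"
    by (auto simp: length_Suc_conv)
  then have "a \<in> arcs G" "arc_to_ends G a = (u, v)"
    by (auto simp: apath_simps arc_to_ends_def)
  then show "u \<rightarrow> v"
    by (auto intro: dominatesI)
next
  assume "u \<rightarrow> v"
  then obtain a where "a \<in> arcs G" "tail G a = u" "head G a = v"
    by (auto simp: arcs_ends_def arc_to_ends_def)
  then have "apath u [a] v"
    using assms(2) by (auto simp: apath_simps)
  then show "graph_dist G u v = 1"
    unfolding graph_dist_def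
    using assms(2) by (intro Least_equality) (auto simp: apath_Nil_iff Suc_le_eq)
qed

text \<open>
  A vertex adjacent to exactly one of \<open>u\<close> and \<open>v\<close> is at distance one from exactly one of them.
\<close>
lemma (in sym_digraph) local_adjacency_imp_local_resolving_set:
  assumes "strongly_connected G" "local_adjacency_resolving_set G S"
  shows "local_resolving_set G S"
  unfolding local_resolving_set_def
proof (intro conjI ballI impI)
  show "S \<subseteq> verts G"
    using assms(2) by (simp add: local_adjacency_resolving_set_def)
  fix u v
  assume u: "u \<in> verts G - S" and v: "v \<in> verts G - S" and "u \<rightarrow> v"
  then obtain w where w: "w \<in> S" "(w \<rightarrow> u) \<noteq> (w \<rightarrow> v)"
    using assms(2) unfolding local_adjacency_resolving_set_def by blast
  have "graph_dist G x w = 1 \<longleftrightarrow> w \<rightarrow> x" if "x \<in> verts G - S" for x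
  proof -
    have "x \<rightarrow>\<^sup>* w" "x \<noteq> w"
      using that w(1) \<open>S \<subseteq> verts G\<close> assms(1) by (auto simp: strongly_connected_def)
    then show ?thesis
      using graph_dist_eq_1_iff[of x w] by (auto intro: graph_symmetric)
  qed
  then have "distinguishes G w u v"
    unfolding distinguishes_def using u v w(2) by metis
  then show "\<exists>w\<in>S. distinguishes G w u v"
    using w(1) by blast
qed

lemma digraph_iso_card_verts:
  assumes "digraph_iso G H"
  shows "card (verts H) = card (verts G)"
proof -
  obtain f where f: "pre_digraph.digraph_isomorphism G f" "H = app_iso f G"
    using assms unfolding digraph_iso_def by blast
  then have "inj_on (iso_verts f) (verts G)"
    by (simp add: pre_digraph.digraph_isomorphism_def)
  then show ?thesis
    using f(2) by (simp add: app_iso_def card_image)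
qed

section \<open>Complete graphs minus an edge\<close>

definition complete_minus_edge :: "nat \<Rightarrow> nat pair_pre_digraph" where
  "complete_minus_edge n =
     \<lparr>pverts = {..<n}, parcs = {(u, v). u < n \<and> v < n \<and> u \<noteq> v \<and> {u, v} \<noteq> {0, 1}}\<rparr>"

lemma complete_minus_edge_simps [simp]:
  "pverts (complete_minus_edge n) = {..<n}"
  "(u, v) \<in> parcs (complete_minus_edge n) \<longleftrightarrow> u < n \<and> v < n \<and> u \<noteq> v \<and> {u, v} \<noteq> {0, 1}"
  by (auto simp: complete_minus_edge_def)

lemma pair_graph_complete_minus_edge: "pair_graph (complete_minus_edge n)"
proof
  have "parcs (complete_minus_edge n) \<subseteq> {..<n} \<times> {..<n}"
    by (auto simp: complete_minus_edge_def)
  then show "finite (parcs (complete_minus_edge n))"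
    by (rule finite_subset) simp
  show "symmetric (with_proj (complete_minus_edge n))"
    unfolding symmetric_def with_proj_simps
    by (rule symI) (auto simp: insert_commute)
qed (auto simp: complete_minus_edge_def)

lemma strongly_connected_complete_minus_edge:
  assumes "3 \<le> n"
  shows "strongly_connected (with_proj (complete_minus_edge n))"
proof (rule strongly_connectedI)
  let ?G = "with_proj (complete_minus_edge n)"
  interpret pair_graph "complete_minus_edge n"
    by (rule pair_graph_complete_minus_edge)
  show "verts ?G \<noteq> {}"
    using assms by (auto simp: lessThan_empty_iff)
  have to_2: "u \<rightarrow>\<^sup>*\<^bsub>?G\<^esub> 2" and from_2: "2 \<rightarrow>\<^sup>*\<^bsub>?G\<^esub> u" if "u < n" for u
  proof -
    have "u = 2 \<or> u \<rightarrow>\<^bsub>?G\<^esub> 2" "u = 2 \<or> 2 \<rightarrow>\<^bsub>?G\<^esub> u"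
      using that assms by (auto simp: doubleton_eq_iff)
    then show "u \<rightarrow>\<^sup>*\<^bsub>?G\<^esub> 2" "2 \<rightarrow>\<^sup>*\<^bsub>?G\<^esub> u"
      using that by (auto intro: reachable_adjI reachable_refl simp del: complete_minus_edge_simps(2) with_proj_simps(3))
  qed
  fix u v
  assume "u \<in> verts ?G"
    and "v \<in> verts ?G"
  then show "u \<rightarrow>\<^sup>*\<^bsub>?G\<^esub> v"
    using to_2[of u] from_2[of v] by (auto intro: reachable_trans)
qed

lemma clique_number_complete_minus_edge:
  assumes "2 \<le> n"
  shows "clique_number (with_proj (complete_minus_edge n)) = n - 1"
  unfolding clique_number_def
proof (rule Max_eqI)
  let ?cliques = "{K. is_clique (with_proj (complete_minus_edge n)) K}"
  have "?cliques \<subseteq> Pow {..<n}"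
    by (auto simp: is_clique_def)
  then show "finite (card ` ?cliques)"
    by (intro finite_imageI) (rule finite_subset, auto)
  have "is_clique (with_proj (complete_minus_edge n)) ({..<n} - {0})"
    by (auto simp: is_clique_def doubleton_eq_iff)
  moreover have "card ({..<n} - {0}) = n - 1"
    using assms by simp
  ultimately show "n - 1 \<in> card ` ?cliques"
    by force
  fix k
  assume "k \<in> card ` ?cliques"
  then obtain K where K: "is_clique (with_proj (complete_minus_edge n)) K" "k = card K"
    by blast
  then have sub: "K \<subseteq> {..<n}"
    by (auto simp: is_clique_def)
  have "\<not> {0, 1} \<subseteq> K"
    using K(1) by (auto simp: is_clique_def)
  with sub assms have "K \<subset> {..<n}"
    by auto
  then have "card K < n"
    using psubset_card_mono[of "{..<n}" K] by simp
  then show "k \<le> n - 1"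
    using K(2) by simp
qed

text \<open>
  If \<open>0\<close> and \<open>1\<close> are both outside \<open>S\<close>, then \<open>0\<close> has no non-neighbour in \<open>S\<close>, and it is paired with
  a third vertex. Otherwise two of the three vertices outside \<open>S\<close> are adjacent to every other vertex
  of the graph.
\<close>
lemma complete_minus_edge_twins:
  assumes "S \<subseteq> {..<n}" "3 \<le> card ({..<n} - S)"
  obtains u v where "u \<in> {..<n} - S" "v \<in> {..<n} - S"
    "u \<rightarrow>\<^bsub>with_proj (complete_minus_edge n)\<^esub> v"
    "\<And>w. w \<in> S \<Longrightarrow> u \<rightarrow>\<^bsub>with_proj (complete_minus_edge n)\<^esub> w"
    "\<And>w. w \<in> S \<Longrightarrow> v \<rightarrow>\<^bsub>with_proj (complete_minus_edge n)\<^esub> w"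
proof (cases "{0, 1} \<subseteq> {..<n} - S")
  case True
  have "card ({..<n} - S - {0, 1}) \<noteq> 0"
    using assms(2) True by (simp add: card_Diff_subset)
  then obtain v where "v \<in> {..<n} - S - {0, 1}"
    by (metis all_not_in_conv card.empty)
  moreover have "w < n \<and> w \<noteq> 0 \<and> w \<noteq> 1" if "w \<in> S" for w
    using that True assms(1) by (metis Diff_iff insert_subset lessThan_iff subsetD)
  ultimately show ?thesis
    using True by (intro that[of 0 v]) (auto simp: doubleton_eq_iff)
next
  case False
  have "card (({..<n} - S) \<inter> {0, 1}) \<le> 1"
  proof -
    have "({..<n} - S) \<inter> {0, 1} \<subset> {0, 1}"
      using False by blast
    then have "card (({..<n} - S) \<inter> {0, 1}) < card {0::nat, 1}"
      by (rule psubset_card_mono[rotated]) simp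
    then show ?thesis
      by simp
  qed
  moreover have "card ({..<n} - S) =
      card (({..<n} - S) \<inter> {0, 1}) + card ({..<n} - S - {0, 1})"
    by (subst card_Int_Diff[of _ "{0, 1}"]) simp_all
  ultimately have "2 \<le> card ({..<n} - S - {0, 1})"
    using assms(2) by linarith
  then obtain T where T: "T \<subseteq> {..<n} - S - {0, 1}" "card T = 2"
    by (meson obtain_subset_with_card_n)
  then obtain u v where "T = {u, v}" "u \<noteq> v"
    by (meson card_2_iff)
  with T(1) assms(1) show ?thesis
    by (intro that[of u v]) (auto simp: doubleton_eq_iff)
qed

lemma card_local_resolving_set_complete_minus_edge:
  assumes "3 \<le> n" "local_resolving_set (with_proj (complete_minus_edge n)) S"
  shows "n - 2 \<le> card S"
proof (rule ccontr)
  let ?G = "with_proj (complete_minus_edge n)"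
  interpret pair_graph "complete_minus_edge n"
    by (rule pair_graph_complete_minus_edge)
  assume "\<not> n - 2 \<le> card S"
  moreover have S: "S \<subseteq> {..<n}"
    using assms(2) by (simp add: local_resolving_set_def)
  ultimately have "3 \<le> card ({..<n} - S)"
    using assms(1) by (simp add: card_Diff_subset finite_subset)
  with S obtain u v where uv: "u \<in> {..<n} - S" "v \<in> {..<n} - S" "u \<rightarrow>\<^bsub>?G\<^esub> v"
    and adj: "\<And>w. w \<in> S \<Longrightarrow> u \<rightarrow>\<^bsub>?G\<^esub> w" "\<And>w. w \<in> S \<Longrightarrow> v \<rightarrow>\<^bsub>?G\<^esub> w"
    using complete_minus_edge_twins by blast
  have "\<exists>w\<in>S. distinguishes ?G w u v"
    using assms(2) uv unfolding local_resolving_set_def with_proj_simps(1)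
      complete_minus_edge_simps(1) by blast
  then obtain w where w: "w \<in> S" "distinguishes ?G w u v"
    by blast
  have "graph_dist ?G x w = 1" if "x \<rightarrow>\<^bsub>?G\<^esub> w" for x
    using that graph_dist_eq_1_iff[of x w] by (auto simp: reachable_adjI)
  with adj w show False
    by (simp add: distinguishes_def)
qed

lemma local_adjacency_resolving_set_complete_minus_edge:
  assumes "3 \<le> n"
  shows "local_adjacency_resolving_set (with_proj (complete_minus_edge n)) ({..<n} - {0, 2})"
proof -
  let ?G = "with_proj (complete_minus_edge n)"
  have "(1 \<rightarrow>\<^bsub>?G\<^esub> u) \<noteq> (1 \<rightarrow>\<^bsub>?G\<^esub> v)" if "{u, v} = {0, 2}" for u v
    using assms that by (auto simp: doubleton_eq_iff)
  moreover have "{u, v} = {0, 2}" if "u \<in> {0, 2}" "v \<in> {0, 2}" "u \<rightarrow>\<^bsub>?G\<^esub> v" for u v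
    using that by auto
  moreover have "1 \<in> {..<n} - {0, 2}"
    using assms by simp
  moreover have "verts ?G - ({..<n} - {0, 2}) \<subseteq> {0, 2}" "{..<n} - {0, 2} \<subseteq> verts ?G"
    by auto
  ultimately show ?thesis
    unfolding local_adjacency_resolving_set_def by (meson subsetD)
qed

lemma dims_complete_minus_edge:
  assumes "3 \<le> n"
  shows "local_metric_dim (with_proj (complete_minus_edge n)) = n - 2"
    and "local_adjacency_metric_dim (with_proj (complete_minus_edge n)) = n - 2"
proof -
  interpret pair_graph "complete_minus_edge n"
    by (rule pair_graph_complete_minus_edge)
  note imp = local_adjacency_imp_local_resolving_set
    [OF strongly_connected_complete_minus_edge[OF assms]]
  note adj = local_adjacency_resolving_set_complete_minus_edge[OF assms]
  note lower = card_local_resolving_set_complete_minus_edge[OF assms]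
  have card: "card ({..<n} - {0, 2}) = n - 2"
    using assms by (simp add: card_Diff_subset)
  show "local_metric_dim (with_proj (complete_minus_edge n)) = n - 2"
    unfolding local_metric_dim_def
  proof (rule Least_equality)
    show "\<exists>S. local_resolving_set (with_proj (complete_minus_edge n)) S \<and> card S = n - 2"
      using imp[OF adj] card by blast
  qed (use lower in blast)
  show "local_adjacency_metric_dim (with_proj (complete_minus_edge n)) = n - 2"
    unfolding local_adjacency_metric_dim_def
  proof (rule Least_equality)
    show "\<exists>S. local_adjacency_resolving_set (with_proj (complete_minus_edge n)) S \<and> card S = n - 2"
      using adj card by blast
  qed (use lower imp in blast)
qed

section \<open>An infinite family attaining the bound\<close>

lemma floor_complete_minus_edge:
  assumes "4 \<le> n"
  shows "\<lfloor>(real (n - 1) - 2) / (real (n - 1) - 1) * real n\<rfloor> = int (n - 2)"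
proof -
  obtain m where n: "n = m + 4"
    using assms by (metis add.commute le_Suc_ex)
  show ?thesis
    unfolding n by (rule floor_unique) (auto simp: field_simps)
qed

theorem mainTheorem3:
  shows "\<exists>\<G> :: nat pair_pre_digraph set.
    infinite \<G> \<and>
    pairwise (\<lambda>G H. \<not> digraph_iso (with_proj G) (with_proj H)) \<G> \<and>
    (\<forall>G\<in>\<G>.
       pair_graph G \<and> Digraph_Component.connected (with_proj G) \<and>
       card (pverts G) \<ge> clique_number (with_proj G) + 1 \<and>
       clique_number (with_proj G) + 1 \<ge> 4 \<and>
       local_adjacency_metric_dim (with_proj G) = local_metric_dim (with_proj G) \<and>
       int (local_metric_dim (with_proj G)) =
         \<lfloor>(real (clique_number (with_proj G)) - 2) / (real (clique_number (with_proj G)) - 1)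
           * real (card (pverts G))\<rfloor>)"
proof (intro exI[of _ "complete_minus_edge ` {4..}"] conjI ballI)
  have "inj complete_minus_edge"
    by (metis complete_minus_edge_simps(1) card_lessThan injI)
  then show "infinite (complete_minus_edge ` {4..})"
    by (meson finite_imageD infinite_Ici inj_on_subset subset_UNIV)
  show "pairwise (\<lambda>G H. \<not> digraph_iso (with_proj G) (with_proj H)) (complete_minus_edge ` {4..})"
    by (auto simp: pairwise_def dest: digraph_iso_card_verts)
  fix G
  assume "G \<in> complete_minus_edge ` {4..}"
  then obtain n where n: "4 \<le> n" and G: "G = complete_minus_edge n"
    by auto
  show "pair_graph G"
    unfolding G by (rule pair_graph_complete_minus_edge)
  then interpret pair_graph G .
  show "Digraph_Component.connected (with_proj G)"
    using strongly_connected_complete_minus_edge[of n] n reachable_mk_symmetric_eq[OF sym_arcs]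
    by (intro connectedI) (auto simp: G strongly_connected_def)
  have clique: "clique_number (with_proj G) = n - 1" and card: "card (pverts G) = n"
    using n by (simp_all add: G clique_number_complete_minus_edge)
  then show "card (pverts G) \<ge> clique_number (with_proj G) + 1"
    and "clique_number (with_proj G) + 1 \<ge> 4"
    using n by simp_all
  show "local_adjacency_metric_dim (with_proj G) = local_metric_dim (with_proj G)"
    using n by (simp add: G dims_complete_minus_edge)
  show "int (local_metric_dim (with_proj G)) =
      \<lfloor>(real (clique_number (with_proj G)) - 2) / (real (clique_number (with_proj G)) - 1)
        * real (card (pverts G))\<rfloor>"
    unfolding clique card floor_complete_minus_edge[OF n]
    using n by (simp add: G dims_complete_minus_edge)
qed

end
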